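(* Let $m,n\geq 0$ and let $w$ be a word with $m$ letters $\mathsf{n}$ and $n$ letters $\mathsf{e}$. For $0\leq k\leq\min(m,n)$ let $\delta_k=\mathsf{e}^{n-k}(\mathsf{ne})^k\mathsf{n}^{m-k}$, and let $m_w$ be the largest integer $k$ such that the path of $\delta_k$ lies weakly below the path of $w$. Write the expansion of $w$ in the basis $\{\delta_k\}$ of $\mathscr{P}_{m,n}$ as $w=\sum_{k}d_{w,k}\,\delta_k$ with $d_{w,k}\in\mathbb{C}(q)$. Then $d_{w,k}=0$ for $k>m_w$, and for $0\leq k\leq m_w$ we have $d_{w,k}=(-1)^{m_w-k}c_{w,k}(q)$ with $c_{w,k}(q)\in\mathbb{Z}_{\geq 0}[q]$.
   Context: Let $q$ be an indeterminate. $\mathscr{P}$ denotes the noncommutative associative unital $\mathbb{C}(q)$-algebra generated by $\mathsf{n},\mathsf{e}$ subject to $(1+q)\,\mathsf{ene}=q\,\mathsf{een}+\mathsf{nee}$ and $(1+q)\,\mathsf{nen}=q\,\mathsf{enn}+\mathsf{nne}$; $\mathscr{P}_{m,n}$ is the span of the words with $m$ letters $\mathsf{n}$ and $n$ letters $\mathsf{e}$ (the relations are homogeneous, so $\mathscr{P}=\bigoplus\mathscr{P}_{m,n}$). It is known (PBW theorem for down-up algebras) that the staircase monomials $\mathsf{e}^a(\mathsf{ne})^b\mathsf{n}^c$, $a,b,c\geq 0$, form a basis of $\mathscr{P}$; hence $\{\delta_k:0\leq k\leq\min(m,n)\}$ is a basis of $\mathscr{P}_{m,n}$. A word with $m$ letters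 $\mathsf{n}$ and $n$ letters $\mathsf{e}$ is identified with the lattice path from $(0,0)$ to $(n,m)$ read left to right ($\mathsf{n}$ = unit north step, $\mathsf{e}$ = unit east step); its partition $\lambda(w)$ is the set of cells of the $m\times n$ box lying to the upper-left of the path. The path of $u$ lies weakly below the path of $w$ if $\lambda(w)\subseteq\lambda(u)$ (so $\delta_0$ lies weakly below every path and $m_w\geq 0$). *)

theory Defs
  imports
    "HOL-Library.Poly_Mapping"
    "HOL-Computational_Algebra.Polynomial_Factorial"
begin

section \<open>Words in the letters \<open>n\<close> and \<open>e\<close>\<close>

datatype letter = N | E

text \<open>Lists under concatenation are the free monoid. It is written additively because
  \<^theory>\<open>HOL-Library.Poly_Mapping\<close> obtains the convolution product of a monoid algebra from an
  addition on the keys.\<close>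

instantiation list :: (type) monoid_add
begin

definition zero_list :: "'a list" where
  "0 = []"

definition plus_list :: "'a list \<Rightarrow> 'a list \<Rightarrow> 'a list" where
  "u + v = u @ v"

instance
  by standard (simp_all add: zero_list_def plus_list_def)

end


section \<open>The algebra \<open>P\<close> over \<open>\<complex>(q)\<close>\<close>

type_synonym Cq = "complex poly fract"

definition q :: Cq where
  "q = to_fract [:0, 1:]"

type_synonym free_alg = "letter list \<Rightarrow>\<^sub>0 Cq"

text \<open>The elements \<open>(1+q) ene - q een - nee\<close> and \<open>(1+q) nen - q enn - nne\<close> of the free algebra.\<close>

definition relators :: "free_alg set" where
  "relators =
     {Poly_Mapping.single [E, N, E] (1 + q)
        - Poly_Mapping.single [E, E, N] q - Poly_Mapping.single [N, E, E] 1,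
      Poly_Mapping.single [N, E, N] (1 + q)
        - Poly_Mapping.single [E, N, N] q - Poly_Mapping.single [N, N, E] 1}"

text \<open>The two-sided ideal generated by the relators. Scalars need no separate clause, as they
  may be absorbed in \<open>a\<close>.\<close>

inductive_set rel_ideal :: "free_alg set" where
  zero: "0 \<in> rel_ideal"
| gen: "r \<in> relators \<Longrightarrow> a * r * b \<in> rel_ideal"
| add: "x \<in> rel_ideal \<Longrightarrow> y \<in> rel_ideal \<Longrightarrow> x + y \<in> rel_ideal"

lemma rel_ideal_mult_left: "x \<in> rel_ideal \<Longrightarrow> c * x \<in> rel_ideal"
proof (induction rule: rel_ideal.induct)
  case zero
  show ?case by (simp add: rel_ideal.zero)
next
  case (gen r a b)
  then have "(c * a) * r * b \<in> rel_ideal" by (rule rel_ideal.gen)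
  then show ?case by (simp add: mult.assoc)
next
  case (add x y)
  then show ?case by (simp add: distrib_left rel_ideal.add)
qed

lemma rel_ideal_mult_right: "x \<in> rel_ideal \<Longrightarrow> x * c \<in> rel_ideal"
proof (induction rule: rel_ideal.induct)
  case zero
  show ?case by (simp add: rel_ideal.zero)
next
  case (gen r a b)
  then have "a * r * (b * c) \<in> rel_ideal" by (rule rel_ideal.gen)
  then show ?case by (simp add: mult.assoc)
next
  case (add x y)
  then show ?case by (simp add: distrib_right rel_ideal.add)
qed

lemma rel_ideal_uminus: "x \<in> rel_ideal \<Longrightarrow> - x \<in> rel_ideal"
  using rel_ideal_mult_left[of x "- 1"] by simp

quotient_type P = free_alg / "\<lambda>x y. x - y \<in> rel_ideal"
proof (rule equivpI)
  show "reflp (\<lambda>x y. x - y \<in> rel_ideal)"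
    by (simp add: reflp_def rel_ideal.zero)
  show "symp (\<lambda>x y. x - y \<in> rel_ideal)"
    by (metis (no_types, lifting) minus_diff_eq rel_ideal_uminus sympI)
  show "transp (\<lambda>x y. x - y \<in> rel_ideal)"
  proof (rule transpI)
    fix x y z :: free_alg
    assume "x - y \<in> rel_ideal" "y - z \<in> rel_ideal"
    then have "(x - y) + (y - z) \<in> rel_ideal" by (rule rel_ideal.add)
    then show "x - z \<in> rel_ideal" by simp
  qed
qed

instantiation P :: ring_1
begin

lift_definition zero_P :: P is 0 .

lift_definition one_P :: P is 1 .

lift_definition plus_P :: "P \<Rightarrow> P \<Rightarrow> P" is "(+)"
proof -
  fix x x' y y' :: free_alg
  assume "x - x' \<in> rel_ideal" "y - y' \<in> rel_ideal"
  then have "(x - x') + (y - y') \<in> rel_ideal" by (rule rel_ideal.add)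
  then show "x + y - (x' + y') \<in> rel_ideal" by (simp add: algebra_simps)
qed

lift_definition uminus_P :: "P \<Rightarrow> P" is uminus
proof -
  fix x x' :: free_alg
  assume "x - x' \<in> rel_ideal"
  then have "- (x - x') \<in> rel_ideal" by (rule rel_ideal_uminus)
  then show "- x - - x' \<in> rel_ideal" by (simp add: algebra_simps)
qed

lift_definition minus_P :: "P \<Rightarrow> P \<Rightarrow> P" is "(-)"
proof -
  fix x x' y y' :: free_alg
  assume "x - x' \<in> rel_ideal" "y - y' \<in> rel_ideal"
  then have "(x - x') + - (y - y') \<in> rel_ideal"
    by (intro rel_ideal.add rel_ideal_uminus)
  then show "x - y - (x' - y') \<in> rel_ideal" by (simp add: algebra_simps)
qed

lift_definition times_P :: "P \<Rightarrow> P \<Rightarrow> P" is "(*)"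
proof -
  fix x x' y y' :: free_alg
  assume "x - x' \<in> rel_ideal" "y - y' \<in> rel_ideal"
  then have "(x - x') * y + x' * (y - y') \<in> rel_ideal"
    by (intro rel_ideal.add rel_ideal_mult_left rel_ideal_mult_right)
  then show "x * y - x' * y' \<in> rel_ideal" by (simp add: algebra_simps)
qed

text \<open>For \<open>0 \<noteq> 1\<close> one uses the representation of \<open>P\<close> in which both generators act as zero,
  that is, the coefficient of the empty word.\<close>

instance
proof
  fix a b c :: P
  show "a * b * c = a * (b * c)" by transfer (simp add: mult.assoc rel_ideal.zero)
  show "1 * a = a" by transfer (simp add: rel_ideal.zero)
  show "a * 1 = a" by transfer (simp add: rel_ideal.zero)
  show "a + b + c = a + (b + c)" by transfer (simp add: add.assoc rel_ideal.zero)
  show "a + b = b + a" by transfer (simp add: add.commute rel_ideal.zero)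
  show "0 + a = a" by transfer (simp add: rel_ideal.zero)
  show "- a + a = 0" by transfer (simp add: rel_ideal.zero)
  show "a - b = a + - b" by transfer (simp add: rel_ideal.zero)
  show "(a + b) * c = a * c + b * c" by transfer (simp add: distrib_right rel_ideal.zero)
  show "a * (b + c) = a * b + a * c" by transfer (simp add: distrib_left rel_ideal.zero)
  have *: "Poly_Mapping.lookup (x * y) [] = Poly_Mapping.lookup x [] * Poly_Mapping.lookup y []"
    for x y :: free_alg
  proof -
    have "Poly_Mapping.lookup (x * y) [] =
        Sum_any (\<lambda>l. Poly_Mapping.lookup x l * Sum_any (\<lambda>r. Poly_Mapping.lookup y r when [] = l + r))"
      by (simp add: lookup_mult)
    also have "\<dots> = Sum_any (\<lambda>l. Poly_Mapping.lookup x l * Poly_Mapping.lookup y [] when l = [])"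
    proof (rule Sum_any.cong)
      fix l :: "letter list"
      have "Sum_any (\<lambda>r. Poly_Mapping.lookup y r when [] = l + r) =
          Sum_any (\<lambda>r. (Poly_Mapping.lookup y r when l = []) when r = [])"
        by (rule Sum_any.cong) (auto simp: plus_list_def when_def)
      then show "Poly_Mapping.lookup x l * Sum_any (\<lambda>r. Poly_Mapping.lookup y r when [] = l + r)
          = (Poly_Mapping.lookup x l * Poly_Mapping.lookup y [] when l = [])"
        by (auto simp: when_def)
    qed
    finally show ?thesis by simp
  qed
  have "Poly_Mapping.lookup x [] = 0" if "x \<in> rel_ideal" for x
    using that
    by induction (auto simp: * relators_def lookup_minus lookup_add lookup_single)
  moreover have "Poly_Mapping.lookup (0 - 1 :: free_alg) [] \<noteq> 0"
    by (simp add: lookup_minus lookup_one zero_list_def)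
  ultimately have "0 - 1 \<notin> rel_ideal" by blast
  then show "(0 :: P) \<noteq> 1" by transfer
qed

end

text \<open>In the monoid algebra, the scalar \<open>c\<close> is \<open>c\<close> times the empty word, here written \<open>0\<close>.\<close>

definition scalar_P :: "Cq \<Rightarrow> P" where
  "scalar_P c = abs_P (Poly_Mapping.single 0 c)"

definition scale_P :: "Cq \<Rightarrow> P \<Rightarrow> P" (infixr "*\<^sub>P" 75) where
  "c *\<^sub>P x = scalar_P c * x"

definition gen_P :: "letter \<Rightarrow> P" where
  "gen_P l = abs_P (Poly_Mapping.single [l] 1)"

definition word_P :: "letter list \<Rightarrow> P" where
  "word_P w = prod_list (map gen_P w)"

lemma single_0_commute:
  fixes x :: free_alg
  shows "Poly_Mapping.single 0 c * x = x * Poly_Mapping.single 0 c"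
proof (induction x rule: update_induct)
  case const
  show ?case by simp
next
  case (update f a b)
  have "Poly_Mapping.update a b f = f + Poly_Mapping.single a b"
    using update.hyps
    by (intro poly_mapping_eqI)
      (auto simp: lookup_update lookup_add lookup_single when_def in_keys_iff)
  with update.IH show ?case
    by (simp add: distrib_left distrib_right mult_single mult.commute)
qed

lemma scalar_P_commute: "scalar_P c * x = x * scalar_P c"
  unfolding scalar_P_def
  by (induction x rule: P.abs_induct) (simp add: times_P.abs_eq single_0_commute)

lemma scalar_P_add: "scalar_P (c + d) = scalar_P c + scalar_P d"
  by (simp add: scalar_P_def plus_P.abs_eq single_add)

lemma scalar_P_mult: "scalar_P (c * d) = scalar_P c * scalar_P d"
  by (simp add: scalar_P_def times_P.abs_eq mult_single)

lemma scalar_P_1: "scalar_P 1 = 1"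
  by (simp add: scalar_P_def one_P_def)

global_interpretation P: vector_space scale_P
  by standard
    (simp_all add: scale_P_def scalar_P_add scalar_P_mult scalar_P_1 algebra_simps)

lemma word_P_eq: "word_P w = abs_P (Poly_Mapping.single w 1)"
proof (induction w)
  case Nil
  have "Poly_Mapping.single [] 1 = (1 :: free_alg)"
    by (metis single_one zero_list_def)
  then show ?case by (simp add: word_P_def one_P_def)
next
  case (Cons l w)
  have "word_P (l # w) = gen_P l * word_P w" by (simp add: word_P_def)
  with Cons show ?case
    by (simp add: gen_P_def times_P.abs_eq mult_single plus_list_def)
qed

lemma P_relation_ene:
  "(1 + q) *\<^sub>P word_P [E, N, E] = q *\<^sub>P word_P [E, E, N] + word_P [N, E, E]"
proof -
  have "1 * (Poly_Mapping.single [E, N, E] (1 + q) - Poly_Mapping.single [E, E, N] q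
      - Poly_Mapping.single [N, E, E] 1) * 1 \<in> rel_ideal"
    by (rule rel_ideal.gen) (simp add: relators_def)
  then show ?thesis
    by (simp add: word_P_eq scale_P_def scalar_P_def times_P.abs_eq plus_P.abs_eq mult_single
        P.abs_eq_iff algebra_simps)
qed

lemma P_relation_nen:
  "(1 + q) *\<^sub>P word_P [N, E, N] = q *\<^sub>P word_P [E, N, N] + word_P [N, N, E]"
proof -
  have "1 * (Poly_Mapping.single [N, E, N] (1 + q) - Poly_Mapping.single [E, N, N] q
      - Poly_Mapping.single [N, N, E] 1) * 1 \<in> rel_ideal"
    by (rule rel_ideal.gen) (simp add: relators_def)
  then show ?thesis
    by (simp add: word_P_eq scale_P_def scalar_P_def times_P.abs_eq plus_P.abs_eq mult_single
        P.abs_eq_iff algebra_simps)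
qed


section \<open>Paths, partitions and staircase words\<close>

text \<open>The pair \<open>(i, j)\<close> stands for the unit cell in row \<open>i\<close> (counted from the bottom) and column
  \<open>j\<close> (counted from the left), both from \<open>0\<close>. It lies to the upper-left of the path iff the east
  step of the path crossing column \<open>j\<close> is at height at most \<open>i\<close>.\<close>

definition partition_of :: "letter list \<Rightarrow> (nat \<times> nat) set" where
  "partition_of w = {(i, j). i < count_list w N \<and>
     (\<exists>u v. w = u @ E # v \<and> count_list u E = j \<and> count_list u N \<le> i)}"

definition weakly_below :: "letter list \<Rightarrow> letter list \<Rightarrow> bool" where
  "weakly_below u w \<longleftrightarrow> partition_of w \<subseteq> partition_of u"

definition delta :: "nat \<Rightarrow> nat \<Rightarrow> nat \<Rightarrow> letter list" where
  "delta m n k = replicate (n - k) E @ concat (replicate k [N, E]) @ replicate (m - k) N"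

text \<open>For a word \<open>w\<close> with \<open>m\<close> letters \<open>n\<close> and \<open>n\<close> letters \<open>e\<close>, the set below contains \<open>0\<close>, since
  \<open>partition_of (delta m n 0)\<close> is the whole box.\<close>

definition max_delta :: "nat \<Rightarrow> nat \<Rightarrow> letter list \<Rightarrow> nat" where
  "max_delta m n w = Max {k. k \<le> min m n \<and> weakly_below (delta m n k) w}"

end

theory Submission
  imports Defs
begin

text \<open>Let \<open>e\<close> map \<open>x^s\<close> to \<open>x^(s+1)\<close> and \<open>n\<close> map \<open>x^s\<close> to \<open>(1 - z q^s) x^(s-1)\<close>. This represents \<open>P\<close>
  for every scalar \<open>z\<close>, and \<open>w\<close> maps \<open>x^0\<close> to a power of \<open>x\<close> times the product of the factors
  \<open>1 - z q^s\<close>, where \<open>s\<close> is \<open>#e - #n\<close> to the right of the letter \<open>n\<close> in question. At \<open>z = q^j\<close> the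
  products of the staircase words form a triangular system, so that these words are independent;
  that they span follows from the fact that the combinations of \<open>ne\<close> and \<open>en\<close> commute and can be
  moved past \<open>n\<close> and \<open>e\<close>. The coefficients of \<open>w\<close> may thus be computed in the commutative setting.
  If \<open>h\<close> is the largest value of \<open>#n - #e\<close> on a suffix of \<open>w\<close>, then \<open>m_w = m - h\<close>, and the product of \<open>w\<close>
  contains the factors with \<open>s = 0, -1, ..., 1 - h\<close>, while the others have \<open>s > - h\<close>. After a shift of \<open>z\<close>
  it remains to expand a product of factors with \<open>s > 0\<close>, which is done one factor at a time.\<close>

section \<open>The scalars\<close>

lemma q_power: "q ^ i = to_fract (monom 1 i)"
proof (induction i)
  case (Suc i)
  have "q ^ Suc i = to_fract ([:0, 1:] * monom 1 i)"
    using Suc by (simp add: q_def del: mult_pCons_left mult_pCons_right)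
  also have "[:0, 1:] * monom 1 i = (monom 1 (Suc i) :: complex poly)"
    by (simp add: monom_Suc)
  finally show ?case .
qed simp

lemma q_nonzero [simp]: "q \<noteq> 0"
  by (simp add: q_def)

lemma q_power_neq_1: "0 < i \<Longrightarrow> q ^ i \<noteq> 1"
  by (metis degree_monom_eq degree_1 less_irrefl one_neq_zero q_power to_fract_1 to_fract_eq_iff)

text \<open>The image of N[q] in the field, in the shape in which the theorem asks for its
  coefficients.\<close>

definition qnonneg :: "Cq set" where
  "qnonneg = range (\<lambda>c :: nat poly. to_fract (map_poly of_nat c))"

lemma qnonneg_0 [simp]: "0 \<in> qnonneg"
  unfolding qnonneg_def by (rule range_eqI[of _ _ 0]) simp

lemma qnonneg_1 [simp]: "1 \<in> qnonneg"
  unfolding qnonneg_def by (rule range_eqI[of _ _ 1]) simp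

lemma qnonneg_q [simp]: "q \<in> qnonneg"
  unfolding qnonneg_def q_def by (rule range_eqI[of _ _ "[:0, 1:]"]) (simp add: map_poly_pCons)

lemma map_poly_of_nat_add:
  "map_poly of_nat (a + b) = map_poly of_nat a + (map_poly of_nat b :: complex poly)"
  by (rule poly_eqI) (simp add: coeff_map_poly)

lemma map_poly_of_nat_mult:
  "map_poly of_nat (a * b) = map_poly of_nat a * (map_poly of_nat b :: complex poly)"
  by (rule poly_eqI) (simp add: coeff_map_poly coeff_mult)

lemma qnonneg_add [intro]:
  assumes "x \<in> qnonneg" "y \<in> qnonneg"
  shows "x + y \<in> qnonneg"
proof -
  from assms obtain a b :: "nat poly"
    where "x = to_fract (map_poly of_nat a)" "y = to_fract (map_poly of_nat b)"
    by (auto simp: qnonneg_def)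
  then have "x + y = to_fract (map_poly of_nat (a + b))"
    by (simp add: map_poly_of_nat_add)
  then show ?thesis
    unfolding qnonneg_def by (rule range_eqI)
qed

lemma qnonneg_mult [intro]:
  assumes "x \<in> qnonneg" "y \<in> qnonneg"
  shows "x * y \<in> qnonneg"
proof -
  from assms obtain a b :: "nat poly"
    where "x = to_fract (map_poly of_nat a)" "y = to_fract (map_poly of_nat b)"
    by (auto simp: qnonneg_def)
  then have "x * y = to_fract (map_poly of_nat (a * b))"
    by (simp add: map_poly_of_nat_mult)
  then show ?thesis
    unfolding qnonneg_def by (rule range_eqI)
qed

definition qint :: "nat \<Rightarrow> Cq" where
  "qint i = (\<Sum>l<i. q ^ l)"

lemma qnonneg_qint [simp]: "qint i \<in> qnonneg"
proof -
  have "q ^ l \<in> qnonneg" for l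
    by (induction l) auto
  then show ?thesis
    unfolding qint_def by (induction i) auto
qed

lemma qint_Suc: "qint (Suc i) = qint i + q ^ i"
  by (simp add: qint_def)

lemma qint_Suc_shift: "qint (Suc i) = 1 + q * qint i"
  by (simp add: qint_def sum.lessThan_Suc_shift sum_distrib_left del: sum.lessThan_Suc)


section \<open>Sign-alternating expansions of products of linear factors\<close>

definition lin :: "Cq \<Rightarrow> int \<Rightarrow> Cq" where
  "lin z i = 1 - z * q powi i"

lemma lin_shift: "lin (z * q powi k) i = lin z (i + k)"
  by (simp add: lin_def power_int_add mult_ac)

text \<open>As functions of \<open>z\<close>, all factors \<open>lin z i\<close> lie in the span of
  \<open>1\<close> and \<open>z\<close>, so two of them suffice. With \<open>a\<close> a natural
  number, both \<open>qint (Suc a)\<close> and \<open>q * qint a\<close> lie in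
  \<open>qnonneg\<close>: this is the source of the alternating signs.\<close>

lemma lin_Suc: "lin z (1 + int a) = qint (Suc a) * lin z 1 - q * qint a * lin z 0"
proof -
  have "q powi (1 + int a) = q * q ^ a"
    by (simp add: power_int_add)
  moreover have "q * qint a = qint a + q ^ a - 1"
    using qint_Suc[of a] qint_Suc_shift[of a] by (simp add: algebra_simps)
  ultimately show ?thesis
    by (simp add: lin_def qint_Suc algebra_simps)
qed

text \<open>The scalar of the staircase word \<open>delta p n (p - j)\<close>, see \<open>act_delta\<close>.\<close>

definition stair :: "Cq \<Rightarrow> nat \<Rightarrow> nat \<Rightarrow> Cq" where
  "stair z p j = (\<Prod>l<j. lin z (- int l)) * lin z (1 - int j) ^ (p - j)"

lemma prod_lin_shift:
  "(\<Prod>l<r. lin z (- int l)) * (\<Prod>l<j. lin (z * q powi - int r) (- int l)) = (\<Prod>l<r + j. lin z (- int l))"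
proof (induction j)
  case (Suc j)
  have "lin (z * q powi - int r) (- int j) = lin z (- int (r + j))"
    by (simp add: lin_shift algebra_simps)
  with Suc show ?case
    by (simp flip: mult.assoc)
qed simp

text \<open>The shift of \<open>z\<close> makes the initial product continue where the prefactor
  stops, while the exponent \<open>p - j = (p + r) - (j + r)\<close> is kept.\<close>

lemma stair_shift:
  "(\<Prod>l<r. lin z (- int l)) * stair (z * q powi - int r) p j = stair z (p + r) (j + r)"
proof -
  have "lin (z * q powi - int r) (1 - int j) = lin z (1 - int (j + r))"
    by (simp add: lin_shift algebra_simps)
  then show ?thesis
    using prod_lin_shift[of z r j] by (simp add: stair_def add.commute[of r] flip: mult.assoc)
qed

text \<open>A set of functions of \<open>z\<close>, so that one choice of \<open>b\<close> serves
  every \<open>z\<close>; only such uniform coefficients can be compared with those in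
  \<open>P\<close>.\<close>

definition alternating :: "nat \<Rightarrow> (Cq \<Rightarrow> Cq) set" where
  "alternating p = {f. \<exists>b. (\<forall>j. b j \<in> qnonneg) \<and> (\<forall>z. f z = (\<Sum>j\<le>p. (- 1) ^ j * b j * stair z p j))}"

lemma alternating_add:
  assumes "f \<in> alternating p" "g \<in> alternating p"
  shows "(\<lambda>z. f z + g z) \<in> alternating p"
proof -
  from assms obtain b c where "\<forall>j. b j \<in> qnonneg" "\<forall>j. c j \<in> qnonneg"
    and "\<forall>z. f z = (\<Sum>j\<le>p. (- 1) ^ j * b j * stair z p j)"
    and "\<forall>z. g z = (\<Sum>j\<le>p. (- 1) ^ j * c j * stair z p j)"
    by (auto simp: alternating_def)
  then show ?thesis
    unfolding alternating_def
    by (intro CollectI exI[of _ "\<lambda>j. b j + c j"]) (auto simp: algebra_simps sum.distrib)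
qed

lemma alternating_scale:
  assumes "f \<in> alternating p" "c \<in> qnonneg"
  shows "(\<lambda>z. c * f z) \<in> alternating p"
proof -
  from assms obtain b where "\<forall>j. b j \<in> qnonneg"
    and "\<forall>z. f z = (\<Sum>j\<le>p. (- 1) ^ j * b j * stair z p j)"
    by (auto simp: alternating_def)
  with assms(2) show ?thesis
    unfolding alternating_def
    by (intro CollectI exI[of _ "\<lambda>j. c * b j"]) (auto simp: sum_distrib_left mult_ac)
qed

lemma alternating_sum:
  assumes "finite I" "\<And>i. i \<in> I \<Longrightarrow> f i \<in> alternating p"
  shows "(\<lambda>z. \<Sum>i\<in>I. f i z) \<in> alternating p"
  using assms
proof (induction I)
  case empty
  show ?case
    by (simp add: alternating_def exI[of _ "\<lambda>_. 0"])
next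
  case (insert i I)
  then show ?case
    using alternating_add[of "f i" p "\<lambda>z. \<Sum>i\<in>I. f i z"] by simp
qed

lemma alternating_stair:
  assumes "j \<le> p"
  shows "(\<lambda>z. (- 1) ^ j * stair z p j) \<in> alternating p"
  unfolding alternating_def
proof (intro CollectI exI[of _ "\<lambda>i. if i = j then 1 else 0"] conjI allI)
  fix z
  have "(\<Sum>i\<le>p. (- 1) ^ i * (if i = j then 1 else 0) * stair z p i)
      = (\<Sum>i\<le>p. if i = j then (- 1) ^ j * stair z p j else 0)"
    by (rule sum.cong) auto
  with assms show "(- 1) ^ j * stair z p j = (\<Sum>i\<le>p. (- 1) ^ i * (if i = j then 1 else 0) * stair z p i)"
    by simp
qed simp

lemma alternating_shift:
  assumes "f \<in> alternating p"
  shows "(\<lambda>z. (- 1) ^ r * ((\<Prod>l<r. lin z (- int l)) * f (z * q powi - int r))) \<in> alternating (p + r)"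
proof -
  from assms obtain b where b: "\<And>j. b j \<in> qnonneg"
    and f: "\<And>z. f z = (\<Sum>j\<le>p. (- 1) ^ j * b j * stair z p j)"
    by (auto simp: alternating_def)
  have "(- 1) ^ r * ((\<Prod>l<r. lin z (- int l)) * f (z * q powi - int r))
      = (\<Sum>j\<le>p. b j * ((- 1) ^ (j + r) * stair z (p + r) (j + r)))" for z
    by (simp add: f sum_distrib_left stair_shift[symmetric] power_add mult_ac)
  moreover have "(\<lambda>z. \<Sum>j\<le>p. b j * ((- 1) ^ (j + r) * stair z (p + r) (j + r))) \<in> alternating (p + r)"
    using b by (intro alternating_sum alternating_scale alternating_stair) auto
  ultimately show ?thesis
    by simp
qed

text \<open>Multiplying \<open>stair z p j\<close> by a further factor, one splits the factor along
  \<open>lin z (1 - j)\<close> and \<open>lin z (- j)\<close>. The first part gives \<open>stair z (Suc p) j\<close>, the second one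
  is a shifted product of only \<open>p - j\<close> factors and contributes the extra sign.\<close>

lemma prod_lin_alternating:
  "(\<lambda>z. \<Prod>a\<leftarrow>as. lin z (1 + int a)) \<in> alternating (length as)"
proof (induction "length as" arbitrary: as rule: less_induct)
  case less
  show ?case
  proof (cases as)
    case Nil
    then show ?thesis
      using alternating_stair[of 0 0] by (simp add: stair_def)
  next
    case (Cons a as')
    define p where "p = length as'"
    have "(\<lambda>z. \<Prod>a\<leftarrow>as'. lin z (1 + int a)) \<in> alternating p"
      using less Cons by (simp add: p_def)
    then obtain b where b: "\<And>j. b j \<in> qnonneg"
      and prod_as': "\<And>z. (\<Prod>a\<leftarrow>as'. lin z (1 + int a)) = (\<Sum>j\<le>p. (- 1) ^ j * b j * stair z p j)"
      by (auto simp: alternating_def)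
    \<comment> \<open>Since \<open>2 - Suc j = 1 - j\<close>, the shifted factor is
      \<open>lin z (1 - int j)\<close>. Thus \<open>g j z\<close> is
      \<open>(- 1) ^ Suc j * stair z p j * lin z (- int j)\<close>, written as a shifted
      product.\<close>
    define g where "g = (\<lambda>j z. (- 1) ^ Suc j *
      ((\<Prod>l<Suc j. lin z (- int l)) * (lin (z * q powi - int (Suc j)) 2) ^ (p - j)))"
    have g: "g j \<in> alternating (Suc p)" if "j \<le> p" for j
    proof -
      have "(\<lambda>z. \<Prod>a\<leftarrow>replicate (p - j) 1. lin z (1 + int a)) \<in> alternating (p - j)"
        using less(1)[of "replicate (p - j) 1"] Cons by (simp add: p_def)
      from alternating_shift[OF this, of "Suc j"] that show ?thesis
        by (simp add: g_def prod_list_replicate map_replicate_const[symmetric] flip: replicate_Suc)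
    qed
    \<comment> \<open>This is \<open>lin_Suc\<close> after shifting \<open>z\<close> by
      \<open>q powi - int j\<close>, whence \<open>a + j\<close> in place of
      \<open>a\<close>.\<close>
    have split: "lin z (1 + int a)
        = qint (Suc (a + j)) * lin z (1 - int j) - q * qint (a + j) * lin z (- int j)" for z j
      using lin_Suc[of "z * q powi - int j" "a + j"] by (simp add: lin_shift algebra_simps)
    have "(- 1) ^ j * b j * stair z p j * lin z (1 + int a)
        = b j * qint (Suc (a + j)) * ((- 1) ^ j * stair z (Suc p) j) + b j * (q * qint (a + j)) * g j z"
      if "j \<le> p" for z j
      using that by (simp add: split[of z j] g_def stair_def lin_shift Suc_diff_le algebra_simps)
    then have "(\<Prod>a\<leftarrow>as. lin z (1 + int a)) = (\<Sum>j\<le>p.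
        b j * qint (Suc (a + j)) * ((- 1) ^ j * stair z (Suc p) j) + b j * (q * qint (a + j)) * g j z)"
      for z
      by (simp add: Cons prod_as' sum_distrib_left sum_distrib_right mult.commute)
    moreover have "(\<lambda>z. \<Sum>j\<le>p.
        b j * qint (Suc (a + j)) * ((- 1) ^ j * stair z (Suc p) j) + b j * (q * qint (a + j)) * g j z)
      \<in> alternating (Suc p)"
      using b g
      by (intro alternating_sum alternating_add alternating_scale alternating_stair qnonneg_mult) auto
    ultimately show ?thesis
      by (simp add: Cons p_def)
  qed
qed

section \<open>Linear independence of the staircase products\<close>

lemma lin_eq_0_iff: "lin (q ^ j) (- int l) = 0 \<longleftrightarrow> j = l"
proof -
  have "lin (q ^ j) (- int l) = 0 \<longleftrightarrow> q ^ l = q ^ j"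
    by (simp add: lin_def power_int_minus field_simps)
  also have "\<dots> \<longleftrightarrow> j = l"
    by (metis degree_monom_eq one_neq_zero q_power to_fract_eq_iff)
  finally show ?thesis .
qed

lemma stair_at_power_eq_0: "j < i \<Longrightarrow> stair (q ^ j) p i = 0"
  by (auto simp: stair_def lin_eq_0_iff)

lemma stair_at_power_neq_0: "stair (q ^ j) p j \<noteq> 0"
proof -
  have "q powi (1 - int j) * q ^ j = q"
    by (simp add: power_int_diff)
  then have "lin (q ^ j) (1 - int j) = 1 - q"
    by (simp add: lin_def mult.commute)
  then show ?thesis
    using q_power_neq_1[of 1] by (simp add: stair_def lin_eq_0_iff)
qed

text \<open>At \<open>z = q ^ (m - k)\<close> the terms with index below \<open>k\<close> vanish by
  \<open>stair_at_power_eq_0\<close>, and those above \<open>k\<close> by downward induction, which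
  leaves \<open>a k\<close> times a nonzero scalar.\<close>

lemma stair_independent:
  assumes "K \<le> m" and sum0: "\<And>z. (\<Sum>k\<le>K. a k * stair z m (m - k)) = 0" and "k \<le> K"
  shows "a k = 0"
  using \<open>k \<le> K\<close>
proof (induction "K - k" arbitrary: k rule: less_induct)
  case less
  have "a i * stair (q ^ (m - k)) m (m - i) = 0" if "i \<le> K" "i \<noteq> k" for i
  proof (cases "i < k")
    case True
    then have "m - k < m - i"
      using less.prems assms(1) by simp
    then show ?thesis
      by (simp add: stair_at_power_eq_0)
  qed (use less that in simp)
  then have "(\<Sum>i\<in>{..K} - {k}. a i * stair (q ^ (m - k)) m (m - i)) = 0"
    by (intro sum.neutral) blast
  then have "(\<Sum>i\<le>K. a i * stair (q ^ (m - k)) m (m - i)) = a k * stair (q ^ (m - k)) m (m - k)"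
    using less.prems by (simp add: sum.remove[of "{..K}" k])
  then show ?case
    using sum0 stair_at_power_neq_0 by (metis mult_eq_0_iff)
qed


section \<open>Staircase words below a path\<close>

text \<open>The maximum of \<open>#n - #e\<close> over all suffixes, the empty one included.\<close>

fun peak :: "letter list \<Rightarrow> nat" where
  "peak [] = 0"
| "peak (E # w) = peak w"
| "peak (N # w) = max (peak w) (Suc (count_list w N) - count_list w E)"

lemma peak_le_iff: "peak w \<le> b \<longleftrightarrow> (\<forall>u v. w = u @ v \<longrightarrow> count_list v N \<le> count_list v E + b)"
proof (induction w rule: peak.induct)
  case (2 w)
  then show ?case
    by (auto simp: Cons_eq_append_conv all_conj_distrib le_SucI dest: spec[of _ "[]"])
next
  case (3 w)
  then show ?case
    by (auto simp: Cons_eq_append_conv all_conj_distrib)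
qed simp

lemma peak_le_count: "peak w \<le> count_list w N"
  by (induction w rule: peak.induct) auto

lemma count_list_le_peak: "count_list w N \<le> count_list w E + peak w"
  using peak_le_iff[of w "peak w"] by (metis append_Nil order_refl)

lemma count_list_replicate: "count_list (replicate k x) y = (if x = y then k else 0)"
  by (induction k) auto

lemma count_list_concat_replicate: "count_list (concat (replicate k u)) y = k * count_list u y"
  by (induction k) auto

lemma count_list_delta:
  assumes "k \<le> min m n"
  shows "count_list (delta m n k) N = m" "count_list (delta m n k) E = n"
  using assms by (simp_all add: delta_def count_list_replicate count_list_concat_replicate)

lemma split_at_letter:
  "j < count_list w x \<Longrightarrow> \<exists>u v. w = u @ x # v \<and> count_list u x = j"
proof (induction w arbitrary: j)
  case (Cons y w)
  show ?case
  proof (cases "x = y \<and> j = 0")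
    case True
    then show ?thesis
      by (intro exI[of _ "[]"] exI[of _ w]) auto
  next
    case False
    with Cons.prems have "(if x = y then j - 1 else j) < count_list w x"
      by (auto split: if_splits)
    then obtain u v where "w = u @ x # v" "count_list u x = (if x = y then j - 1 else j)"
      using Cons.IH by blast
    with False show ?thesis
      by (intro exI[of _ "y # u"] exI[of _ v]) auto
  qed
qed simp

text \<open>Each \<open>E\<close> completes a pair \<open>[N, E]\<close>, so its own
  \<open>N\<close> is the only unmatched letter before it.\<close>

lemma height_zigzag:
  "concat (replicate k [N, E]) @ replicate c N = u @ E # v \<Longrightarrow> count_list u N = Suc (count_list u E)"
proof (induction k arbitrary: u)
  case 0
  then have "E \<in> set (replicate c N)"
    by simp
  then show ?case
    by simp
next
  case (Suc k)
  then show ?case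
    by (auto simp: Cons_eq_append_conv)
qed

text \<open>The truncated subtraction gives height \<open>0\<close> for the initial run of
  \<open>n - k\<close> east steps.\<close>

lemma height_delta:
  assumes "delta m n k = u @ E # v"
  shows "count_list u N = Suc (count_list u E) - (n - k)"
proof -
  have "replicate a E @ concat (replicate k [N, E]) @ replicate c N = u @ E # v
      \<Longrightarrow> count_list u N = Suc (count_list u E) - a" for a c
  proof (induction a arbitrary: u)
    case 0
    then show ?case
      using height_zigzag by simp
  next
    case (Suc a)
    then show ?case
      by (auto simp: Cons_eq_append_conv)
  qed
  then show ?thesis
    using assms unfolding delta_def .
qed

text \<open>Only the heights of the east steps matter. If \<open>w = u @ E # v\<close>, then by
  \<open>height_delta\<close> this step is at least as high as that of the staircase in the same
  column iff \<open>count_list v N <= count_list v E + (m - k)\<close>.\<close>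

lemma weakly_below_delta_iff:
  assumes k: "k \<le> min m n" and m: "count_list w N = m" and n: "count_list w E = n"
  shows "weakly_below (delta m n k) w \<longleftrightarrow> peak w \<le> m - k"
proof
  assume below: "weakly_below (delta m n k) w"
  have "count_list v N \<le> count_list v E + (m - k)" if "w = u @ v" for u v
    using that
  proof (induction u arbitrary: v rule: rev_induct)
    case Nil
    then show ?case
      using m n k by auto
  next
    case (snoc x u)
    show ?case
    proof (cases x)
      case N
      then show ?thesis
        \<comment> \<open>Prepending \<open>N\<close> only makes the inequality stronger, so the
          longer suffix implies it for \<open>v\<close>.\<close>
        using snoc.IH[of "N # v"] snoc.prems by simp
    next
      case E
      show ?thesis
      \<comment> \<open>If no \<open>N\<close> follows, the column has no cell above the path, but
        the bound is trivial. Otherwise the lowest such cell is compared.\<close>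
      proof (cases "count_list v N = 0")
        case False
        have w: "w = u @ E # v"
          using snoc.prems E by simp
        then have "(count_list u N, count_list u E) \<in> partition_of w"
          using False by (auto simp: partition_of_def)
        then have "(count_list u N, count_list u E) \<in> partition_of (delta m n k)"
          using below by (auto simp: weakly_below_def)
        then obtain u' v' where "delta m n k = u' @ E # v'"
          "count_list u' E = count_list u E" "count_list u' N \<le> count_list u N"
          by (auto simp: partition_of_def)
        then have "Suc (count_list u E) - (n - k) \<le> count_list u N"
          using height_delta by metis
        then show ?thesis
          using w m n k by auto
      qed simp
    qed
  qed
  then show "peak w \<le> m - k"
    by (simp add: peak_le_iff)
next
  assume peak: "peak w \<le> m - k"
  show "weakly_below (delta m n k) w"
    unfolding weakly_below_def
  proof
    fix x
    assume "x \<in> partition_of w"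
    then obtain i u v where x: "x = (i, count_list u E)" and i: "i < m" "count_list u N \<le> i"
      and w: "w = u @ E # v"
      using m by (auto simp: partition_of_def)
    have "count_list u E < n"
      using w n by auto
    then have "count_list u E < count_list (delta m n k) E"
      by (simp only: count_list_delta[OF k])
    from split_at_letter[OF this] obtain u' v' where delta: "delta m n k = u' @ E # v'"
      and u': "count_list u' E = count_list u E"
      by blast
    have counts: "m = count_list u N + count_list v N" "n = Suc (count_list u E + count_list v E)"
      using w m n by simp_all
    have "w = (u @ [E]) @ v"
      using w by simp
    then have "count_list v N \<le> count_list v E + (m - k)"
      using peak unfolding peak_le_iff by blast
    then have "count_list u' N \<le> i"
      using height_delta[OF delta] u' counts i k by simp
    then show "x \<in> partition_of (delta m n k)"
      using x i delta u' count_list_delta(1)[OF k]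
      by (simp only: partition_of_def mem_Collect_eq case_prod_conv) blast
  qed
qed

lemma max_delta_eq:
  assumes "count_list w N = m" "count_list w E = n"
  shows "max_delta m n w = m - peak w"
  unfolding max_delta_def
proof (rule Max_eqI)
  show "m - peak w \<in> {k. k \<le> min m n \<and> weakly_below (delta m n k) w}"
    using weakly_below_delta_iff[OF _ assms, of "m - peak w"] assms
      count_list_le_peak[of w] peak_le_count[of w] by simp
next
  fix k
  assume "k \<in> {k. k \<le> min m n \<and> weakly_below (delta m n k) w}"
  then show "k \<le> m - peak w"
    using weakly_below_delta_iff[OF _ assms, of k] by auto
qed simp


section \<open>The action on powers\<close>

definition weight :: "letter list \<Rightarrow> int" where
  "weight w = int (count_list w E) - int (count_list w N)"

text \<open>The effect on \<open>x^0\<close>. Replacing \<open>z\<close> by \<open>z q^s\<close> gives the effect on \<open>x^s\<close>.\<close>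

fun act :: "Cq \<Rightarrow> letter list \<Rightarrow> Cq" where
  "act z [] = 1"
| "act z (E # w) = act z w"
| "act z (N # w) = lin z (weight w) * act z w"

text \<open>The right factor acts first and takes \<open>x^0\<close> to a multiple of
  \<open>x\<close> to the power \<open>weight v\<close>, where \<open>u\<close> then starts.\<close>

lemma act_append: "act z (u @ v) = act (z * q powi weight v) u * act z v"
  by (induction z u rule: act.induct) (simp_all add: lin_shift weight_def algebra_simps)

lemma act_replicate_E [simp]: "act z (replicate a E) = 1"
  by (induction a) simp_all

lemma act_replicate_N: "act z (replicate c N) = (\<Prod>l<c. lin z (- int l))"
  by (induction c) (simp_all add: weight_def count_list_replicate)

lemma act_zigzag: "act z (concat (replicate k [N, E])) = lin z 1 ^ k"
  by (induction k) (simp_all add: weight_def count_list_concat_replicate)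

lemma act_delta:
  assumes "k \<le> m"
  shows "act z (delta m n k) = stair z m (m - k)"
proof -
  have "weight (replicate (m - k) N) = - int (m - k)"
    by (simp add: weight_def count_list_replicate)
  then show ?thesis
    using assms by (simp add: delta_def act_append act_zigzag act_replicate_N stair_def lin_shift
        mult.commute del: of_nat_diff)
qed

text \<open>Reading from the right, an \<open>N\<close> that raises the peak from \<open>h\<close>
  to \<open>Suc h\<close> acts in weight \<open>- h\<close> and extends the first product; every
  other \<open>N\<close> acts in a weight above \<open>- h\<close> and is recorded in
  \<open>as\<close>.\<close>

lemma act_peak:
  "\<exists>as. length as = count_list w N - peak w \<and>
    (\<forall>z. act z w = (\<Prod>l<peak w. lin z (- int l)) * (\<Prod>a\<leftarrow>as. lin (z * q powi - int (peak w)) (1 + int a)))"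
proof (induction w rule: peak.induct)
  case 1
  show ?case
    by simp
next
  case (2 w)
  then show ?case
    by simp
next
  case (3 w)
  define h where "h = peak w"
  from 3 obtain as where as: "length as = count_list w N - h"
    and act: "\<And>z. act z w = (\<Prod>l<h. lin z (- int l)) * (\<Prod>a\<leftarrow>as. lin (z * q powi - int h) (1 + int a))"
    by (auto simp: h_def)
  have h: "h \<le> count_list w N" "count_list w N \<le> count_list w E + h"
    using peak_le_count[of w] count_list_le_peak[of w] by (simp_all add: h_def)
  show ?case
  proof (cases "count_list w N < count_list w E + h")
    case True
    define a where "a = count_list w E + h - Suc (count_list w N)"
    have "peak (N # w) = h"
      using True by (simp add: h_def)
    moreover have "lin z (weight w) = lin (z * q powi - int h) (1 + int a)" for z
      using True by (simp add: lin_shift weight_def a_def of_nat_diff)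
    ultimately show ?thesis
      using as h by (intro exI[of _ "a # as"]) (simp add: act Suc_diff_le)
  next
    case False
    then have N: "count_list w N = count_list w E + h"
      using h by simp
    then have "peak (N # w) = Suc h"
      by (simp add: h_def)
    moreover have "weight w = - int h"
      using N by (simp add: weight_def)
    moreover have "lin (z * q powi - int h) (1 + int a)
        = lin (z * q powi - int (Suc h)) (1 + int (Suc a))" for z a
      by (simp add: lin_shift algebra_simps)
    ultimately show ?thesis
      \<comment> \<open>The peak has grown by one, so the earlier exponents, measured from it, grow
        by one as well.\<close>
      using as h by (intro exI[of _ "map Suc as"]) (simp add: act comp_def)
  qed
qed

text \<open>Combines \<open>act_peak\<close> with \<open>prod_lin_alternating\<close>. Restoring the
  factors of the peak turns \<open>j\<close> into \<open>j + peak w\<close>, which belongs to the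
  staircase word with \<open>k = count_list w N - peak w - j\<close>; hence no larger
  \<open>k\<close> occurs.\<close>

lemma act_alternating:
  obtains b where "\<And>j. b j \<in> qnonneg"
    and "\<And>z. act z w = (\<Sum>k\<le>count_list w N - peak w.
      (- 1) ^ (count_list w N - peak w - k) * b k * act z (delta (count_list w N) n k))"
proof -
  define h p where "h = peak w" and "p = count_list w N - h"
  have p: "p + h = count_list w N"
    using peak_le_count[of w] by (simp add: p_def h_def)
  obtain as where as: "length as = p"
    and act: "\<And>z. act z w = (\<Prod>l<h. lin z (- int l)) * (\<Prod>a\<leftarrow>as. lin (z * q powi - int h) (1 + int a))"
    using act_peak[of w] by (auto simp: p_def h_def)
  from prod_lin_alternating[of as] obtain b where b: "\<And>j. b j \<in> qnonneg"
    and prod: "\<And>z. (\<Prod>a\<leftarrow>as. lin z (1 + int a)) = (\<Sum>j\<le>p. (- 1) ^ j * b j * stair z p j)"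
    by (auto simp: alternating_def as)
  have "act z w = (\<Sum>k\<le>p. (- 1) ^ (p - k) * b (p - k) * act z (delta (p + h) n k))" for z
  proof -
    have "act z w = (\<Sum>j\<le>p. (- 1) ^ j * b j * stair z (p + h) (j + h))"
      by (simp add: act prod sum_distrib_left mult_ac flip: stair_shift)
    also have "\<dots> = (\<Sum>k\<le>p. (- 1) ^ (p - k) * b (p - k) * stair z (p + h) (p - k + h))"
      by (rule sum.reindex_bij_witness[of _ "\<lambda>k. p - k" "\<lambda>j. p - j"]) auto
    also have "\<dots> = (\<Sum>k\<le>p. (- 1) ^ (p - k) * b (p - k) * act z (delta (p + h) n k))"
      by (intro sum.cong refl) (simp add: act_delta)
    finally show ?thesis .
  qed
  with b that[of "\<lambda>k. b (p - k)"] show ?thesis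
    unfolding p by (simp add: p_def h_def)
qed


section \<open>Spanning\<close>

lemma scale_P_mult_left: "(c *\<^sub>P x) * y = c *\<^sub>P (x * y)"
  by (simp add: scale_P_def mult.assoc)

lemma scale_P_mult_right: "x * (c *\<^sub>P y) = c *\<^sub>P (x * y)"
  by (metis scale_P_def mult.assoc scalar_P_commute)

lemma word_P_Nil [simp]: "word_P [] = 1"
  by (simp add: word_P_def)

lemma word_P_Cons [simp]: "word_P (l # w) = gen_P l * word_P w"
  by (simp add: word_P_def)

lemma word_P_append: "word_P (u @ v) = word_P u * word_P v"
  by (simp add: word_P_def)

lemma word_P_replicate: "word_P (replicate a l) = gen_P l ^ a"
  by (induction a) simp_all

lemma word_P_zigzag: "word_P (concat (replicate k [N, E])) = (gen_P N * gen_P E) ^ k"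
  by (induction k) (simp_all add: mult.assoc)

lemma word_P_delta:
  "word_P (delta m n k) = gen_P E ^ (n - k) * (gen_P N * gen_P E) ^ k * gen_P N ^ (m - k)"
  by (simp add: delta_def word_P_append word_P_replicate word_P_zigzag mult.assoc)

lemma nee_eq:
  "gen_P N * gen_P E * gen_P E
    = gen_P E * ((1 + q) *\<^sub>P (gen_P N * gen_P E) - q *\<^sub>P (gen_P E * gen_P N))"
  using P_relation_ene by (simp add: right_diff_distrib scale_P_mult_right mult.assoc)

lemma nne_eq:
  "gen_P N * (gen_P N * gen_P E)
    = ((1 + q) *\<^sub>P (gen_P N * gen_P E) - q *\<^sub>P (gen_P E * gen_P N)) * gen_P N"
  using P_relation_nen by (simp add: left_diff_distrib scale_P_mult_left mult.assoc)

text \<open>The same combination \<open>?u\<close> occurs in \<open>nee_eq\<close> and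
  \<open>nne_eq\<close>, so both sides equal \<open>gen_P E * ?u * gen_P N\<close>.\<close>

lemma ne_en_commute:
  "(gen_P N * gen_P E) * (gen_P E * gen_P N) = (gen_P E * gen_P N) * (gen_P N * gen_P E)"
proof -
  let ?u = "(1 + q) *\<^sub>P (gen_P N * gen_P E) - q *\<^sub>P (gen_P E * gen_P N)"
  have "(gen_P N * gen_P E) * (gen_P E * gen_P N) = (gen_P N * gen_P E * gen_P E) * gen_P N"
    by (simp only: mult.assoc)
  also have "\<dots> = gen_P E * ?u * gen_P N"
    by (simp only: nee_eq)
  also have "\<dots> = gen_P E * (?u * gen_P N)"
    by (simp only: mult.assoc)
  also have "\<dots> = gen_P E * (gen_P N * (gen_P N * gen_P E))"
    by (simp only: nne_eq)
  finally show ?thesis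
    by (simp only: mult.assoc)
qed

definition pencil :: "Cq \<times> Cq \<Rightarrow> P" where
  "pencil ab = fst ab *\<^sub>P (gen_P N * gen_P E) + snd ab *\<^sub>P (gen_P E * gen_P N)"

text \<open>The change of coefficients when a combination of \<open>ne\<close> and \<open>en\<close>
  is passed by \<open>N\<close> coming from its left or by \<open>E\<close> coming from its right;
  it is the same in both cases.\<close>

definition twist :: "Cq \<times> Cq \<Rightarrow> Cq \<times> Cq" where
  "twist ab = (fst ab * (1 + q) + snd ab, - (fst ab * q))"

lemma pencil_twist:
  "pencil (twist ab) = fst ab *\<^sub>P ((1 + q) *\<^sub>P (gen_P N * gen_P E) - q *\<^sub>P (gen_P E * gen_P N))
    + snd ab *\<^sub>P (gen_P N * gen_P E)"
  by (simp add: pencil_def twist_def P.scale_left_distrib P.scale_right_distrib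
      P.scale_right_diff_distrib distrib_left)

lemma n_pencil: "gen_P N * pencil ab = pencil (twist ab) * gen_P N"
proof -
  have "gen_P N * pencil ab
      = fst ab *\<^sub>P (gen_P N * (gen_P N * gen_P E)) + snd ab *\<^sub>P (gen_P N * gen_P E * gen_P N)"
    by (simp add: pencil_def distrib_left scale_P_mult_right mult.assoc)
  then show ?thesis
    by (simp add: nne_eq pencil_twist distrib_right scale_P_mult_left)
qed

lemma pencil_e: "pencil ab * gen_P E = gen_P E * pencil (twist ab)"
proof -
  have "pencil ab * gen_P E
      = fst ab *\<^sub>P (gen_P N * gen_P E * gen_P E) + snd ab *\<^sub>P (gen_P E * (gen_P N * gen_P E))"
    by (simp add: pencil_def distrib_right scale_P_mult_left mult.assoc)
  then show ?thesis
    by (simp add: nee_eq pencil_twist distrib_left scale_P_mult_right)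
qed

lemma n_prod_pencil:
  "gen_P N * prod_list (map pencil us) = prod_list (map pencil (map twist us)) * gen_P N"
proof (induction us)
  case (Cons u us)
  have "gen_P N * prod_list (map pencil (u # us))
      = pencil (twist u) * (gen_P N * prod_list (map pencil us))"
    by (simp add: n_pencil flip: mult.assoc)
  then show ?case
    by (simp add: Cons.IH mult.assoc)
qed simp

lemma pencil_e_power: "\<exists>cd. pencil ab * gen_P E ^ a = gen_P E ^ a * pencil cd"
proof (induction a arbitrary: ab)
  case (Suc a)
  obtain cd where "pencil (twist ab) * gen_P E ^ a = gen_P E ^ a * pencil cd"
    using Suc.IH by blast
  then have "pencil ab * gen_P E ^ Suc a = gen_P E ^ Suc a * pencil cd"
    by (metis mult.assoc pencil_e power_Suc)
  then show ?case ..
qed auto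

lemma pencil_ne: "pencil (1, 0) = gen_P N * gen_P E"
  by (simp add: pencil_def)

definition delta_span :: "nat \<Rightarrow> nat \<Rightarrow> P set" where
  "delta_span m n = P.span ((\<lambda>k. word_P (delta m n k)) ` {..min m n})"

lemma delta_span_base:
  "gen_P E ^ a * (gen_P N * gen_P E) ^ b * gen_P N ^ c \<in> delta_span (c + b) (a + b)"
  unfolding delta_span_def by (intro P.span_base image_eqI[of _ _ b]) (auto simp: word_P_delta)

text \<open>The first pencil is expanded. Its \<open>ne\<close> part joins the power of
  \<open>ne\<close>. Its \<open>en\<close> part commutes to the front of that power, its
  \<open>E\<close> joins \<open>gen_P E ^ a\<close>, and its \<open>N\<close> moves right through
  everything else to \<open>gen_P N ^ c\<close>, which leaves one quadratic factor fewer.\<close>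

lemma pencil_delta_span:
  "gen_P E ^ a * ((gen_P N * gen_P E) ^ i * prod_list (map pencil us)) * gen_P N ^ c
    \<in> delta_span (c + (i + length us)) (a + (i + length us))"
proof (induction "i + length us" arbitrary: a c i us)
  case 0
  then show ?case
    using delta_span_base[of a 0 c] by simp
next
  case (Suc p)
  note outer_IH = Suc.hyps(1)
  show ?case
    using Suc.hyps(2)
  proof (induction us arbitrary: i)
    case Nil
    then show ?case
      using delta_span_base[of a i c] by simp
  next
    case (Cons u us)
    let ?n = "gen_P N" and ?e = "gen_P E" and ?X = "prod_list (map pencil us)"
    \<comment> \<open>Twisting turns the \<open>i\<close> factors \<open>ne\<close> into general
      pencils, so they join the list and the power restarts at \<open>0\<close>.\<close>
    let ?us' = "map twist (replicate i (1, 0) @ us)"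
    have en: "(?n * ?e) ^ i * (?e * ?n) = (?e * ?n) * (?n * ?e) ^ i"
      by (rule power_commuting_commutes) (rule ne_en_commute)
    have en': "(?n * ?e) ^ i * (?e * ?n) * ?X = ?e * (?n * ((?n * ?e) ^ i * ?X))"
      by (simp only: en mult.assoc)
    have "(?n * ?e) ^ i * (pencil u * ?X)
        = fst u *\<^sub>P ((?n * ?e) ^ i * (?n * ?e) * ?X) + snd u *\<^sub>P ((?n * ?e) ^ i * (?e * ?n) * ?X)"
      by (simp add: pencil_def distrib_left distrib_right scale_P_mult_left scale_P_mult_right mult.assoc)
    also have "(?n * ?e) ^ i * (?n * ?e) = (?n * ?e) ^ Suc i"
      by (rule power_Suc2[symmetric])
    also have "(?n * ?e) ^ i * (?e * ?n) * ?X = ?e * (?n * prod_list (map pencil (replicate i (1, 0) @ us)))"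
      by (simp add: en' pencil_ne)
    also have "\<dots> = ?e * (prod_list (map pencil ?us') * ?n)"
      by (simp only: n_prod_pencil)
    finally have "?e ^ a * ((?n * ?e) ^ i * prod_list (map pencil (u # us))) * ?n ^ c
        = fst u *\<^sub>P (?e ^ a * ((?n * ?e) ^ Suc i * ?X) * ?n ^ c)
          + snd u *\<^sub>P (?e ^ a * (?e * (prod_list (map pencil ?us') * ?n)) * ?n ^ c)"
      by (simp add: distrib_left distrib_right scale_P_mult_left scale_P_mult_right)
    also have "?e ^ a * (?e * (prod_list (map pencil ?us') * ?n)) * ?n ^ c
        = ?e ^ Suc a * ((?n * ?e) ^ 0 * prod_list (map pencil ?us')) * ?n ^ Suc c"
      by (simp add: power_commutes mult.assoc[symmetric])
    finally have eq: "?e ^ a * ((?n * ?e) ^ i * prod_list (map pencil (u # us))) * ?n ^ c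
        = fst u *\<^sub>P (?e ^ a * ((?n * ?e) ^ Suc i * ?X) * ?n ^ c)
          + snd u *\<^sub>P (?e ^ Suc a * ((?n * ?e) ^ 0 * prod_list (map pencil ?us')) * ?n ^ Suc c)" .
    have "?e ^ a * ((?n * ?e) ^ Suc i * ?X) * ?n ^ c
        \<in> delta_span (c + (i + length (u # us))) (a + (i + length (u # us)))"
      using Cons.IH[of "Suc i"] Cons.prems by simp
    moreover have "?e ^ Suc a * ((?n * ?e) ^ 0 * prod_list (map pencil ?us')) * ?n ^ Suc c
        \<in> delta_span (c + (i + length (u # us))) (a + (i + length (u # us)))"
      using outer_IH[of 0 ?us' "Suc a" "Suc c"] Cons.prems by (simp del: power_Suc)
    ultimately show ?case
      unfolding eq delta_span_def by (intro P.span_add P.span_scale)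
  qed
qed

lemma mult_span:
  assumes "\<And>x. x \<in> S \<Longrightarrow> y * x \<in> P.span T" and "x \<in> P.span S"
  shows "y * x \<in> P.span T"
  using assms(2)
proof (induction rule: P.span_induct_alt)
  case base
  then show ?case
    by (simp add: P.span_zero)
next
  case (step c x y)
  then show ?case
    using assms(1) by (simp add: distrib_left scale_P_mult_right P.span_add P.span_scale)
qed

text \<open>If the staircase word starts with \<open>E\<close>, the new \<open>N\<close> forms
  \<open>ne\<close> with it, and this pencil moves past the remaining letters \<open>E\<close>;
  otherwise \<open>N\<close> itself moves right through the factors \<open>ne\<close>.\<close>

lemma n_delta_span:
  assumes "x \<in> delta_span m n"
  shows "gen_P N * x \<in> delta_span (Suc m) n"
  using assms unfolding delta_span_def
proof (rule mult_span[rotated])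
  fix x
  assume "x \<in> (\<lambda>k. word_P (delta m n k)) ` {..min m n}"
  then obtain k where k: "k \<le> m" "k \<le> n"
    and x: "x = gen_P E ^ (n - k) * (gen_P N * gen_P E) ^ k * gen_P N ^ (m - k)"
    by (auto simp: word_P_delta)
  have "gen_P N * x \<in> delta_span (Suc m) n"
  proof (cases "n - k")
    case 0
    have "gen_P N * x
        = gen_P N * prod_list (map pencil (replicate k (1, 0))) * gen_P N ^ (m - k)"
      by (simp add: x 0 pencil_ne mult.assoc)
    also have "\<dots> = prod_list (map pencil (map twist (replicate k (1, 0)))) * gen_P N ^ Suc (m - k)"
      by (simp only: n_prod_pencil power_Suc mult.assoc)
    finally show ?thesis
      using pencil_delta_span[of 0 0 "map twist (replicate k (1, 0))" "Suc (m - k)"] k 0 by simp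
  next
    case (Suc a)
    then have n: "n = Suc (a + k)"
      using k by simp
    obtain cd where cd: "pencil (1, 0) * gen_P E ^ a = gen_P E ^ a * pencil cd"
      using pencil_e_power by blast
    have "gen_P N * x
        = pencil (1, 0) * gen_P E ^ a * (gen_P N * gen_P E) ^ k * gen_P N ^ (m - k)"
      by (simp add: x Suc pencil_ne mult.assoc)
    also have "\<dots> = gen_P E ^ a * prod_list (map pencil (cd # replicate k (1, 0))) * gen_P N ^ (m - k)"
      by (simp only: cd) (simp add: pencil_ne mult.assoc)
    finally show ?thesis
      using pencil_delta_span[of a 0 "cd # replicate k (1, 0)" "m - k"] k n
      by (simp add: Suc_diff_le[symmetric])
  qed
  then show "gen_P N * x \<in> P.span ((\<lambda>k. word_P (delta (Suc m) n k)) ` {..min (Suc m) n})"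
    by (simp add: delta_span_def)
qed

lemma e_delta_span:
  assumes "x \<in> delta_span m n"
  shows "gen_P E * x \<in> delta_span m (Suc n)"
  using assms unfolding delta_span_def
proof (rule mult_span[rotated])
  fix x
  assume "x \<in> (\<lambda>k. word_P (delta m n k)) ` {..min m n}"
  then obtain k where k: "k \<le> m" "k \<le> n" and x: "x = word_P (delta m n k)"
    by auto
  have "gen_P E * x = word_P (delta m (Suc n) k)"
    using k by (simp add: x word_P_delta Suc_diff_le mult.assoc)
  then show "gen_P E * x \<in> P.span ((\<lambda>k. word_P (delta m (Suc n) k)) ` {..min m (Suc n)})"
    using k by (intro P.span_base) auto
qed

lemma word_P_delta_span: "word_P w \<in> delta_span (count_list w N) (count_list w E)"
proof (induction w)
  case Nil
  show ?case
    using delta_span_base[of 0 0 0] by simp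
next
  case (Cons l w)
  then show ?case
    by (cases l) (simp_all add: n_delta_span e_delta_span)
qed

lemma delta_span_obtains:
  assumes "x \<in> delta_span m n"
  obtains d where "x = (\<Sum>k\<le>min m n. d k *\<^sub>P word_P (delta m n k))"
proof -
  have "\<exists>d. x = (\<Sum>k\<le>min m n. d k *\<^sub>P word_P (delta m n k))"
    using assms unfolding delta_span_def
  proof (induction rule: P.span_induct_alt)
    case base
    show ?case
      by (intro exI[of _ "\<lambda>_. 0"]) simp
  next
    case (step c x y)
    then obtain i d where i: "i \<le> min m n" "x = word_P (delta m n i)"
      and y: "y = (\<Sum>k\<le>min m n. d k *\<^sub>P word_P (delta m n k))"
      by auto
    have "(\<Sum>k\<le>min m n. (if k = i then c else 0) *\<^sub>P word_P (delta m n k))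
        = (\<Sum>k\<le>min m n. if k = i then c *\<^sub>P x else 0)"
      by (rule sum.cong) (auto simp: i(2))
    also have "\<dots> = c *\<^sub>P x"
      using i(1) by simp
    finally have "c *\<^sub>P x + y
        = (\<Sum>k\<le>min m n. ((if k = i then c else 0) + d k) *\<^sub>P word_P (delta m n k))"
      by (simp add: y P.scale_left_distrib sum.distrib)
    then show ?case
      by (intro exI[of _ "\<lambda>k. (if k = i then c else 0) + d k"])
  qed
  then show ?thesis
    using that by blast
qed


section \<open>The representation of \<open>P\<close> on Laurent polynomials\<close>

lemma free_alg_induct [case_names zero add]:
  fixes x :: free_alg
  assumes "Q 0" "\<And>x w c. Q x \<Longrightarrow> Q (x + Poly_Mapping.single w c)"
  shows "Q x"
proof (induction x rule: update_induct)
  case const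
  show ?case by (rule assms(1))
next
  case (update f a b)
  have "Poly_Mapping.update a b f = f + Poly_Mapping.single a b"
    using update.hyps
    by (intro poly_mapping_eqI)
      (auto simp: lookup_update lookup_add lookup_single when_def in_keys_iff)
  with assms(2) update.IH show ?case by simp
qed

text \<open>The image of \<open>x^0\<close> evaluated at \<open>x = 1\<close>, so that words of all
  weights contribute to a single scalar.\<close>

definition act_free :: "Cq \<Rightarrow> free_alg \<Rightarrow> Cq" where
  "act_free z x = Sum_any (\<lambda>w. Poly_Mapping.lookup x w * act z w)"

lemma act_free_zero [simp]: "act_free z 0 = 0"
  by (simp add: act_free_def)

lemma act_free_add: "act_free z (x + y) = act_free z x + act_free z y"
proof -
  have "finite {w. Poly_Mapping.lookup x w * act z w \<noteq> 0}" for x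
    by (rule finite_subset[of _ "{w. Poly_Mapping.lookup x w \<noteq> 0}"]) auto
  then show ?thesis
    unfolding act_free_def lookup_add distrib_right by (intro Sum_any.distrib)
qed

lemma act_free_single [simp]: "act_free z (Poly_Mapping.single w c) = c * act z w"
  by (simp add: act_free_def lookup_single when_mult)

lemma act_free_uminus: "act_free z (- x) = - act_free z x"
  using act_free_add[of z x "- x"] by (simp add: eq_neg_iff_add_eq_0 add.commute)

lemma act_free_diff: "act_free z (x - y) = act_free z x - act_free z y"
  using act_free_add[of z x "- y"] by (simp add: act_free_uminus)

lemma act_free_mult_single:
  "act_free z (x * Poly_Mapping.single v c) = c * act z v * act_free (z * q powi weight v) x"
proof (induction x rule: free_alg_induct)
  case (add x w d)
  then show ?case
    by (simp add: distrib_right distrib_left act_free_add mult_single plus_list_def act_append mult_ac)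
qed simp

text \<open>Both cases rest on \<open>(1 + q) * lin z i = q * lin z (i - 1) + lin z (i + 1)\<close>:
  with \<open>i = 1\<close> for the first relator, and with \<open>i = 0\<close>, multiplied by
  \<open>lin z 0\<close>, for the second.\<close>

lemma act_free_relator: "r \<in> relators \<Longrightarrow> act_free z r = 0"
  by (auto simp: relators_def act_free_diff weight_def lin_def)
    (simp_all add: field_simps power2_eq_square)

text \<open>The three words of a relator have the same weight, so a word to their left contributes
  one common scalar. A factor on the right merely changes \<open>z\<close>, see
  \<open>act_free_mult_single\<close>.\<close>

lemma act_free_mult_relator:
  assumes "r \<in> relators"
  shows "act_free z (a * r) = 0"
proof -
  have single: "act_free z (Poly_Mapping.single w c * r) = 0" for w c
  proof -
    from assms consider
      "r = Poly_Mapping.single [E, N, E] (1 + q)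
        - Poly_Mapping.single [E, E, N] q - Poly_Mapping.single [N, E, E] 1" |
      "r = Poly_Mapping.single [N, E, N] (1 + q)
        - Poly_Mapping.single [E, N, N] q - Poly_Mapping.single [N, N, E] 1"
      by (auto simp: relators_def)
    then show ?thesis
    proof cases
      case 1
      have "act_free z (Poly_Mapping.single w c * r) = c * act (z * q) w * act_free z r"
        unfolding 1
        by (simp add: right_diff_distrib act_free_diff mult_single plus_list_def act_append weight_def)
      then show ?thesis
        using act_free_relator[OF assms] by simp
    next
      case 2
      have "act_free z (Poly_Mapping.single w c * r) = c * act (z * q powi - 1) w * act_free z r"
        unfolding 2
        by (simp add: right_diff_distrib act_free_diff mult_single plus_list_def act_append weight_def)
      then show ?thesis
        using act_free_relator[OF assms] by simp
    qed
  qed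
  show ?thesis
    by (induction a rule: free_alg_induct) (simp_all add: distrib_right act_free_add single)
qed

lemma act_free_rel_ideal: "x \<in> rel_ideal \<Longrightarrow> act_free z x = 0"
proof (induction rule: rel_ideal.induct)
  case (gen r a b)
  then show ?case
    by (induction b rule: free_alg_induct)
      (simp_all add: distrib_left act_free_add act_free_mult_single act_free_mult_relator)
qed (simp_all add: act_free_add)

lift_definition act_P :: "Cq \<Rightarrow> P \<Rightarrow> Cq" is act_free
  using act_free_rel_ideal act_free_diff by (metis eq_iff_diff_eq_0)

lemma act_P_add: "act_P z (x + y) = act_P z x + act_P z y"
  by transfer (rule act_free_add)

lemma act_P_zero [simp]: "act_P z 0 = 0"
  by transfer simp

lemma act_P_sum: "act_P z (\<Sum>i\<in>I. f i) = (\<Sum>i\<in>I. act_P z (f i))"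
  by (induction I rule: infinite_finite_induct) (simp_all add: act_P_add)

lemma act_P_scale_word: "act_P z (c *\<^sub>P word_P w) = c * act z w"
  by (simp add: scale_P_def scalar_P_def word_P_eq times_P.abs_eq mult_single act_P.abs_eq)

lemma act_P_word: "act_P z (word_P w) = act z w"
  by (simp add: word_P_eq act_P.abs_eq)


theorem theorem3p5:
  fixes m n :: nat and w :: "letter list"
  assumes "count_list w N = m" and "count_list w E = n"
  shows "\<exists>d :: nat \<Rightarrow> Cq.
    word_P w = (\<Sum>k\<le>min m n. d k *\<^sub>P word_P (delta m n k)) \<and>
    (\<forall>d'. word_P w = (\<Sum>k\<le>min m n. d' k *\<^sub>P word_P (delta m n k)) \<longrightarrow>
      (\<forall>k\<le>min m n. d' k = d k)) \<and>
    (\<forall>k\<le>min m n. max_delta m n w < k \<longrightarrow> d k = 0) \<and>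
    (\<forall>k\<le>max_delta m n w. \<exists>c :: nat poly.
      d k = (- 1) ^ (max_delta m n w - k) * to_fract (map_poly of_nat c))"
proof -
  define M where "M = max_delta m n w"
  have M: "M = m - peak w"
    using assms by (simp add: M_def max_delta_eq)
  then have "M \<le> min m n"
    using assms count_list_le_peak[of w] peak_le_count[of w] by simp
  obtain b where b: "\<And>k. b k \<in> qnonneg"
    and act: "\<And>z. act z w = (\<Sum>k\<le>M. (- 1) ^ (M - k) * b k * act z (delta m n k))"
    by (rule act_alternating[of w n, unfolded assms, folded M]) blast
  \<comment> \<open>These coefficients come from the scalars \<open>act z w\<close> alone; that they
    expand \<open>w\<close> in \<open>P\<close> is shown only at the end.\<close>
  define d where "d k = (if k \<le> M then (- 1) ^ (M - k) * b k else 0)" for k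
  have act_d: "act z w = (\<Sum>k\<le>min m n. d k * act z (delta m n k))" for z
    unfolding act using \<open>M \<le> min m n\<close> by (intro sum.mono_neutral_cong_left) (auto simp: d_def)
  have unique: "d' k = d k"
    if d': "word_P w = (\<Sum>k\<le>min m n. d' k *\<^sub>P word_P (delta m n k))" and k: "k \<le> min m n" for d' k
  proof -
    have "act z w = (\<Sum>k\<le>min m n. d' k * act z (delta m n k))" for z
      using arg_cong[OF d', of "act_P z"] by (simp add: act_P_word act_P_sum act_P_scale_word)
    then have "(\<Sum>k\<le>min m n. (d' k - d k) * stair z m (m - k)) = 0" for z
      using act_d[of z] by (simp add: left_diff_distrib sum_subtractf act_delta)
    then show ?thesis
      using stair_independent[of "min m n" m "\<lambda>k. d' k - d k" k] k by simp
  qed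
  \<comment> \<open>Spanning provides some expansion, and \<open>unique\<close> identifies its
    coefficients with \<open>d\<close>.\<close>
  obtain d' where d': "word_P w = (\<Sum>k\<le>min m n. d' k *\<^sub>P word_P (delta m n k))"
    using word_P_delta_span[of w] assms delta_span_obtains by metis
  then have "word_P w = (\<Sum>k\<le>min m n. d k *\<^sub>P word_P (delta m n k))"
    using unique[OF d'] by (metis (mono_tags, lifting) atMost_iff sum.cong)
  moreover have "\<exists>c. d k = (- 1) ^ (M - k) * to_fract (map_poly of_nat c)" if "k \<le> M" for k
    using that b[of k] by (auto simp: d_def qnonneg_def)
  moreover have "d k = 0" if "M < k" for k
    using that by (simp add: d_def)
  ultimately show ?thesis
    using unique unfolding M_def by blast
qed

end
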